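(* Let $\bar c_0\ne0$ and $\epsilon_0$ be scalars, let $f_s(z)=\left(\frac{\epsilon_0}{\bar c_0}(1-q^2)q^{-\nu-1}z;q^2\right)_s$ (the eigenfunctions of $W_0=\bar c_0S_-q^{s_3}+\epsilon_0q^{2s_3}$), and let $\mathfrak a,\mathfrak b,\mathfrak c$ be parameters with $\frac{\epsilon_0}{\bar c_0}(1-q^2)q^{-\nu-1}=q^2\mathfrak b\neq0$, with $\mathfrak aq^{2m}\ne1$, $\mathfrak cq^{2m}\neq1$ for all integers $m\ge1$, and $\mathfrak a\mathfrak bq^{2m}\neq1$ for all integers $m\ge2$. Then for every integer $n\ge0$ $$P_n(q^2\mathfrak bz;\mathfrak a,\mathfrak b,\mathfrak c;q^2)=\sum_{s=0}^{\infty}\gamma'_{n,s}f_s(z),\qquad \gamma'_{n,s}=\frac{(q^{-2n};q^2)_s(\mathfrak a\mathfrak bq^{2n+2};q^2)_s}{(q^2\mathfrak a;q^2)_s(q^2\mathfrak c;q^2)_s(q^2;q^2)_s}\,q^{2s}.$$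
   Context: $q\in\mathbb C\setminus\{0\}$ is not a root of unity and $\nu\in\mathbb C$ with $2\nu\notin\mathbb Z_{\ge0}$ (a value of $q^\nu$ is fixed). $q$-shifted factorial: $(a;q)_n=\prod_{k=0}^{n-1}(1-aq^k)$; the sum over $s$ is finite since $(q^{-2n};q^2)_s=0$ for $s>n$. The big $q$-Jacobi polynomial $y(x)=P_n(x;\mathfrak a,\mathfrak b,\mathfrak c;q^2)$ (base $q^2$) is the polynomial of degree $n$ in $x$, normalized by $P_n(1;\mathfrak a,\mathfrak b,\mathfrak c;q^2)=1$, that solves $$q^{-2n}(1-q^{2n})(1-\mathfrak a\mathfrak bq^{2n+2})y(x)=B(x)y(q^2x)+\overline B(x)y(q^{-2}x)-(B(x)+\overline B(x))y(x),$$ $$B(x)=\frac{\mathfrak a\mathfrak cq^2}{x^2}-\frac{\mathfrak a(\mathfrak b+\mathfrak c)q^2}{x}+\mathfrak a\mathfrak bq^2,\qquad \overline B(x)=\frac{\mathfrak a\mathfrak cq^4}{x^2}-\frac{(\mathfrak a+\mathfrak c)q^2}{x}+1 .$$ Here $S_-$ and $q^{s_3}$ are generators of $\mathfrak U_q(sl(2))$ realized on formal power series by $q^{s_3}\mapsto q^{-\nu}T_+$, $S_-\mapsto -z^{-1}\frac{T_--T_+}{q-q^{-1}}$, with $T_\pm f(z)=f(q^{\pm1}z)$. *)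

theory Defs
  imports
    "HOL-Analysis.Analysis"
    "HOL-Computational_Algebra.Computational_Algebra"
begin

definition q_shifted_fact :: "'a::comm_ring_1 \<Rightarrow> 'a \<Rightarrow> nat \<Rightarrow> 'a" where
  "q_shifted_fact a p n = (\<Prod>k<n. 1 - a * p ^ k)"


text \<open>
  Big q-Jacobi polynomials in an arbitrary base \<open>p\<close>; the case of interest is \<open>p = q\<^sup>2\<close>.
  The difference equation involves \<open>x\<^sup>-\<^sup>1\<close>, so it is imposed at the nonzero points only.
\<close>

definition big_q_Jacobi_B :: "complex \<Rightarrow> complex \<Rightarrow> complex \<Rightarrow> complex \<Rightarrow> complex \<Rightarrow> complex" where
  "big_q_Jacobi_B a b c p x = a * c * p / x\<^sup>2 - a * (b + c) * p / x + a * b * p"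

definition big_q_Jacobi_Bbar :: "complex \<Rightarrow> complex \<Rightarrow> complex \<Rightarrow> complex \<Rightarrow> complex" where
  "big_q_Jacobi_Bbar a c p x = a * c * p\<^sup>2 / x\<^sup>2 - (a + c) * p / x + 1"

definition is_big_q_Jacobi ::
    "nat \<Rightarrow> complex \<Rightarrow> complex \<Rightarrow> complex \<Rightarrow> complex \<Rightarrow> complex poly \<Rightarrow> bool" where
  "is_big_q_Jacobi n a b c p y \<longleftrightarrow>
     degree y = n \<and> poly y 1 = 1 \<and>
     (\<forall>x. x \<noteq> 0 \<longrightarrow>
        inverse (p ^ n) * (1 - p ^ n) * (1 - a * b * p ^ (n + 1)) * poly y x =
          big_q_Jacobi_B a b c p x * poly y (p * x)
          + big_q_Jacobi_Bbar a c p x * poly y (inverse p * x)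
          - (big_q_Jacobi_B a b c p x + big_q_Jacobi_Bbar a c p x) * poly y x)"

definition big_q_Jacobi ::
    "nat \<Rightarrow> complex \<Rightarrow> complex \<Rightarrow> complex \<Rightarrow> complex \<Rightarrow> complex poly" where
  "big_q_Jacobi n a b c p = (THE y. is_big_q_Jacobi n a b c p y)"


text \<open>
  The realization on formal power series. Throughout, \<open>qnu\<close> stands for the chosen value of
  \<open>q\<close> to the power \<open>\<nu>\<close>. The series \<open>T_- f - T_+ f\<close> has no constant term, so its product
  with \<open>z\<^sup>-\<^sup>1\<close> is the shift of its coefficients.
\<close>

definition fps_dilate :: "complex \<Rightarrow> complex fps \<Rightarrow> complex fps" where
  "fps_dilate r F = fps_compose F (fps_const r * fps_X)"

definition op_qs3 :: "complex \<Rightarrow> complex \<Rightarrow> complex fps \<Rightarrow> complex fps" where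
  "op_qs3 q qnu F = fps_const (inverse qnu) * fps_dilate q F"

definition op_Sminus :: "complex \<Rightarrow> complex fps \<Rightarrow> complex fps" where
  "op_Sminus q F =
     - fps_shift 1 (fps_const (inverse (q - inverse q)) * (fps_dilate (inverse q) F - fps_dilate q F))"

definition op_W0 ::
    "complex \<Rightarrow> complex \<Rightarrow> complex \<Rightarrow> complex \<Rightarrow> complex fps \<Rightarrow> complex fps" where
  "op_W0 q qnu cbar0 eps0 F =
     fps_const cbar0 * op_Sminus q (op_qs3 q qnu F)
     + fps_const eps0 * op_qs3 q qnu (op_qs3 q qnu F)"

definition W0_alpha :: "complex \<Rightarrow> complex \<Rightarrow> complex \<Rightarrow> complex \<Rightarrow> complex" where
  "W0_alpha q qnu cbar0 eps0 = eps0 / cbar0 * (1 - q\<^sup>2) * inverse (qnu * q)"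

definition W0_eigenfun ::
    "complex \<Rightarrow> complex \<Rightarrow> complex \<Rightarrow> complex \<Rightarrow> nat \<Rightarrow> complex \<Rightarrow> complex" where
  "W0_eigenfun q qnu cbar0 eps0 s z = q_shifted_fact (W0_alpha q qnu cbar0 eps0 * z) (q\<^sup>2) s"

definition W0_eigenseries ::
    "complex \<Rightarrow> complex \<Rightarrow> complex \<Rightarrow> complex \<Rightarrow> nat \<Rightarrow> complex fps" where
  "W0_eigenseries q qnu cbar0 eps0 s =
     q_shifted_fact (fps_const (W0_alpha q qnu cbar0 eps0) * fps_X) (fps_const (q\<^sup>2)) s"

text \<open>
  \<open>W0_eigenfun\<close> is the polynomial function \<open>f_s\<close> and \<open>W0_eigenseries\<close> the same
  polynomial as a formal power series. The next two lemmas confirm that this series is the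
  Taylor series of \<open>f_s\<close> and an eigenvector of \<open>W_0\<close>.
\<close>

lemma W0_eigenfun_has_fps_expansion:
  "W0_eigenfun q qnu cbar0 eps0 s has_fps_expansion W0_eigenseries q qnu cbar0 eps0 s"
proof -
  define \<alpha> where "\<alpha> = W0_alpha q qnu cbar0 eps0"
  have "(\<lambda>z. \<Prod>k<s. 1 - \<alpha> * z * (q\<^sup>2) ^ k) has_fps_expansion
        (\<Prod>k<s. 1 - fps_const \<alpha> * fps_X * fps_const ((q\<^sup>2) ^ k))"
    by (intro fps_expansion_intros has_fps_expansion_prod)
  moreover have "W0_eigenfun q qnu cbar0 eps0 s = (\<lambda>z. \<Prod>k<s. 1 - \<alpha> * z * (q\<^sup>2) ^ k)"
    by (simp add: fun_eq_iff W0_eigenfun_def q_shifted_fact_def \<alpha>_def)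
  ultimately show ?thesis
    by (simp add: W0_eigenseries_def q_shifted_fact_def \<alpha>_def fps_const_power)
qed

lemma op_W0_eigenseries:
  assumes q: "q \<noteq> 0" "q\<^sup>2 \<noteq> 1" and qnu: "qnu \<noteq> 0" and cbar0: "cbar0 \<noteq> 0"
  shows "op_W0 q qnu cbar0 eps0 (W0_eigenseries q qnu cbar0 eps0 s) =
         fps_const (eps0 * q ^ (2 * s) / qnu\<^sup>2) * W0_eigenseries q qnu cbar0 eps0 s"
proof -
  define \<alpha> where "\<alpha> = W0_alpha q qnu cbar0 eps0"
  define F where "F = W0_eigenseries q qnu cbar0 eps0 s"
  define G where "G = fps_dilate (q\<^sup>2) F"
  have F_prod: "F = (\<Prod>k<s. 1 - fps_const (\<alpha> * (q\<^sup>2) ^ k) * fps_X)"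
    by (simp add: F_def W0_eigenseries_def q_shifted_fact_def \<alpha>_def fps_const_power
        flip: fps_const_mult) (simp add: mult_ac)
  have dil_nth: "fps_nth (fps_dilate r H) n = r ^ n * fps_nth H n" for r H n
    by (simp add: fps_dilate_def fps_compose_linear)
  have dil_const: "fps_dilate r (fps_const k * H) = fps_const k * fps_dilate r H" for r k H
    by (rule fps_ext) (simp add: dil_nth)
  have dil_dil: "fps_dilate r (fps_dilate t H) = fps_dilate (r * t) H" for r t H
    by (rule fps_ext) (simp add: dil_nth power_mult_distrib)
  have dil_1: "fps_dilate 1 H = H" for H
    by (rule fps_ext) (simp add: dil_nth)
  have G_prod: "G = (\<Prod>k<s. 1 - fps_const (\<alpha> * (q\<^sup>2) ^ Suc k) * fps_X)"
  proof -
    have "G = (\<Prod>k<s. (1 - fps_const (\<alpha> * (q\<^sup>2) ^ k) * fps_X) oo (fps_const (q\<^sup>2) * fps_X))"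
      by (simp add: G_def fps_dilate_def F_prod fps_compose_prod_distrib)
    also have "\<dots> = (\<Prod>k<s. 1 - fps_const (\<alpha> * (q\<^sup>2) ^ Suc k) * fps_X)"
    proof (rule prod.cong[OF refl])
      fix k
      show "(1 - fps_const (\<alpha> * (q\<^sup>2) ^ k) * fps_X) oo (fps_const (q\<^sup>2) * fps_X)
            = 1 - fps_const (\<alpha> * (q\<^sup>2) ^ Suc k) * fps_X"
        unfolding fps_compose_linear
        by (rule fps_ext) (auto simp: fps_X_def)
    qed
    finally show ?thesis .
  qed
  have func: "(1 - fps_const \<alpha> * fps_X) * G = (1 - fps_const (\<alpha> * (q\<^sup>2) ^ s) * fps_X) * F"
  proof -
    have "(1 - fps_const \<alpha> * fps_X) * G = (\<Prod>k<Suc s. 1 - fps_const (\<alpha> * (q\<^sup>2) ^ k) * fps_X)"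
      unfolding G_prod by (subst prod.lessThan_Suc_shift) simp
    also have "\<dots> = (1 - fps_const (\<alpha> * (q\<^sup>2) ^ s) * fps_X) * F"
      by (simp add: F_prod mult.commute)
    finally show ?thesis .
  qed
  define u where "u = inverse (q - inverse q)"
  have W: "op_W0 q qnu cbar0 eps0 F =
      - (fps_const (cbar0 * u * inverse qnu) * fps_shift 1 (F - G))
      + fps_const (eps0 * inverse (qnu\<^sup>2)) * G"
  proof -
    have "fps_dilate (inverse q) (op_qs3 q qnu F) = fps_const (inverse qnu) * F"
      using q by (simp add: op_qs3_def dil_const dil_dil dil_1)
    moreover have "fps_dilate q (op_qs3 q qnu F) = fps_const (inverse qnu) * G"
      by (simp add: op_qs3_def dil_const dil_dil G_def power2_eq_square)
    ultimately show ?thesis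
      by (intro fps_ext) (simp add: op_W0_def op_Sminus_def op_qs3_def[of _ _ "op_qs3 q qnu F"]
          u_def power2_eq_square algebra_simps)
  qed
  have X_shift: "fps_X * fps_shift 1 (F - G) = F - G"
    by (rule fps_ext) (auto simp: G_def dil_nth)
  have key: "cbar0 * u * inverse qnu * \<alpha> = - eps0 * inverse (qnu\<^sup>2)"
  proof -
    have "q * q \<noteq> 1" using q by (simp add: power2_eq_square)
    then show ?thesis
      using q qnu cbar0
      by (simp add: u_def \<alpha>_def W0_alpha_def divide_simps power2_eq_square) algebra
  qed
  define e where "e = eps0 * inverse (qnu\<^sup>2)"
  define d where "d = cbar0 * u * inverse qnu"
  define t where "t = (q\<^sup>2) ^ s"
  have da: "fps_const d * fps_const \<alpha> = - fps_const e"
    using key by (simp add: d_def e_def)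
  have func': "(1 - fps_const \<alpha> * fps_X) * G = (1 - fps_const \<alpha> * fps_const t * fps_X) * F"
    using func by (simp add: t_def)
  have W': "fps_X * op_W0 q qnu cbar0 eps0 F = - (fps_const d * (F - G)) + fps_X * (fps_const e * G)"
    using X_shift unfolding W d_def e_def by algebra
  have "(fps_X * (1 - fps_const \<alpha> * fps_X)) * op_W0 q qnu cbar0 eps0 F =
        (fps_X * (1 - fps_const \<alpha> * fps_X)) * (fps_const e * fps_const t * F)"
    using W' func' da by algebra
  moreover have "fps_X * (1 - fps_const \<alpha> * fps_X) \<noteq> 0"
  proof -
    have "fps_nth (1 - fps_const \<alpha> * fps_X) 0 \<noteq> 0" by simp
    then have "1 - fps_const \<alpha> * fps_X \<noteq> 0" by (metis fps_zero_nth)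
    then show ?thesis by simp
  qed
  ultimately have "op_W0 q qnu cbar0 eps0 F = fps_const e * fps_const t * F"
    by (metis mult_left_cancel)
  moreover have "t = q ^ (2 * s)"
    by (simp only: t_def power_mult)
  ultimately show ?thesis
    by (simp add: F_def e_def divide_inverse mult_ac)
qed


definition gamma' :: "complex \<Rightarrow> complex \<Rightarrow> complex \<Rightarrow> complex \<Rightarrow> nat \<Rightarrow> nat \<Rightarrow> complex" where
  "gamma' q a b c n s =
     q_shifted_fact (inverse (q ^ (2 * n))) (q\<^sup>2) s * q_shifted_fact (a * b * q ^ (2 * n + 2)) (q\<^sup>2) s
     / (q_shifted_fact (q\<^sup>2 * a) (q\<^sup>2) s * q_shifted_fact (q\<^sup>2 * c) (q\<^sup>2) s * q_shifted_fact (q\<^sup>2) (q\<^sup>2) s)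
     * q ^ (2 * s)"

end

theory Submission
  imports Defs
begin

text \<open>
  Put \<open>p = q\<^sup>2\<close> and \<open>x = p b z\<close>, so that \<open>f\<^sub>s(z) = (x; p)\<^sub>s\<close>. The difference operator \<open>L\<close> of the
  big \<open>q\<close>-Jacobi equation is bidiagonal in this basis:
  \<open>L (x; p)\<^sub>s = \<lambda>\<^sub>s (x; p)\<^sub>s - p\<^sup>-\<^sup>s (1 - p\<^sup>s) (1 - a p\<^sup>s) (1 - c p\<^sup>s) (x; p)\<^sub>s\<^sub>-\<^sub>1\<close> with
  \<open>\<lambda>\<^sub>s = p\<^sup>-\<^sup>s (1 - p\<^sup>s) (1 - a b p\<^sup>s\<^sup>+\<^sup>1)\<close>. The equation \<open>L y = \<lambda>\<^sub>n y\<close> therefore becomes a first-order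
  recurrence for the expansion coefficients, which \<open>\<gamma>'\<close> solves. The solution is unique since the
  degree-\<open>k\<close> coefficient of \<open>L y\<close>, for \<open>y\<close> of degree \<open>k\<close>, is \<open>\<lambda>\<^sub>k\<close> times that of \<open>y\<close>, and
  \<open>\<lambda>\<^sub>k \<noteq> \<lambda>\<^sub>n\<close> for \<open>k < n\<close>.
\<close>

section \<open>Elementary identities for q-shifted factorials\<close>

lemma q_shifted_fact_0 [simp]: "q_shifted_fact a p 0 = 1"
  by (simp add: q_shifted_fact_def)

lemma q_shifted_fact_Suc: "q_shifted_fact a p (Suc n) = q_shifted_fact a p n * (1 - a * p ^ n)"
  by (simp add: q_shifted_fact_def)

lemma q_shifted_fact_Suc_shift:
  "q_shifted_fact a p (Suc n) = (1 - a) * q_shifted_fact (a * p) p n"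
  unfolding q_shifted_fact_def by (subst prod.lessThan_Suc_shift) (simp add: mult.assoc)

lemma q_shifted_fact_eq_0_iff:
  fixes a p :: "'a::idom"
  shows "q_shifted_fact a p n = 0 \<longleftrightarrow> (\<exists>k<n. a * p ^ k = 1)"
  by (auto simp: q_shifted_fact_def)

text \<open>The factor with \<open>k = n\<close> is zero.\<close>

lemma q_shifted_fact_inverse_power_eq_0:
  fixes p :: "'a::field"
  assumes "p \<noteq> 0" "n < s"
  shows "q_shifted_fact (inverse (p ^ n)) p s = 0"
  using assms by (auto simp: q_shifted_fact_eq_0_iff intro!: exI[of _ n])

lemma poly_q_shifted_fact: "poly (q_shifted_fact u v n) x = q_shifted_fact (poly u x) (poly v x) n"
  by (simp add: q_shifted_fact_def poly_prod)

section \<open>The difference operator on the basis of shifted factorials\<close>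

definition big_q_Jacobi_eigenvalue :: "complex \<Rightarrow> complex \<Rightarrow> complex \<Rightarrow> nat \<Rightarrow> complex" where
  "big_q_Jacobi_eigenvalue a b p n = inverse (p ^ n) * (1 - p ^ n) * (1 - a * b * p ^ (n + 1))"

text \<open>Acts on functions rather than polynomials because its coefficients have poles at 0; only
  its values at nonzero points matter.\<close>

definition big_q_Jacobi_op ::
    "complex \<Rightarrow> complex \<Rightarrow> complex \<Rightarrow> complex \<Rightarrow> (complex \<Rightarrow> complex) \<Rightarrow> complex \<Rightarrow> complex" where
  "big_q_Jacobi_op a b c p f x =
     big_q_Jacobi_B a b c p x * f (p * x) + big_q_Jacobi_Bbar a c p x * f (inverse p * x)
     - (big_q_Jacobi_B a b c p x + big_q_Jacobi_Bbar a c p x) * f x"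

lemma is_big_q_Jacobi_iff:
  "is_big_q_Jacobi n a b c p y \<longleftrightarrow> degree y = n \<and> poly y 1 = 1 \<and>
     (\<forall>x. x \<noteq> 0 \<longrightarrow>
        big_q_Jacobi_op a b c p (poly y) x = big_q_Jacobi_eigenvalue a b p n * poly y x)"
  unfolding is_big_q_Jacobi_def big_q_Jacobi_op_def big_q_Jacobi_eigenvalue_def by metis

lemma big_q_Jacobi_op_add:
  "big_q_Jacobi_op a b c p (\<lambda>x. f x + g x) x =
     big_q_Jacobi_op a b c p f x + big_q_Jacobi_op a b c p g x"
  by (simp add: big_q_Jacobi_op_def algebra_simps)

lemma big_q_Jacobi_op_cmult:
  "big_q_Jacobi_op a b c p (\<lambda>x. k * f x) x = k * big_q_Jacobi_op a b c p f x"
  by (simp add: big_q_Jacobi_op_def algebra_simps)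

lemma big_q_Jacobi_op_const: "big_q_Jacobi_op a b c p (\<lambda>x. k) x = 0"
  by (simp add: big_q_Jacobi_op_def algebra_simps)

text \<open>The factor \<open>x\<^sup>2\<close> clears the poles, and both coefficients then split
  into linear factors.\<close>

lemma square_mult_big_q_Jacobi_op:
  assumes "x \<noteq> 0"
  shows "x\<^sup>2 * big_q_Jacobi_op a b c p f x =
     a * p * (x - 1) * (b * x - c) * (f (p * x) - f x)
     + (x - a * p) * (x - c * p) * (f (inverse p * x) - f x)"
proof -
  have B: "x\<^sup>2 * big_q_Jacobi_B a b c p x = a * p * (x - 1) * (b * x - c)"
    using assms by (simp add: big_q_Jacobi_B_def field_simps power2_eq_square)
  have Bbar: "x\<^sup>2 * big_q_Jacobi_Bbar a c p x = (x - a * p) * (x - c * p)"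
    using assms by (simp add: big_q_Jacobi_Bbar_def field_simps power2_eq_square)
  have "x\<^sup>2 * big_q_Jacobi_op a b c p f x =
     (x\<^sup>2 * big_q_Jacobi_B a b c p x) * (f (p * x) - f x)
     + (x\<^sup>2 * big_q_Jacobi_Bbar a c p x) * (f (inverse p * x) - f x)"
    by (simp add: big_q_Jacobi_op_def algebra_simps)
  then show ?thesis unfolding B Bbar .
qed

text \<open>Dilating the argument changes a shifted factorial only in its boundary factors, so every
  term becomes a polynomial multiple of \<open>q_shifted_fact x p s\<close>.\<close>

lemma big_q_Jacobi_op_q_shifted_fact_Suc:
  fixes a b c p x :: complex
  assumes p: "p \<noteq> 0" and x: "x \<noteq> 0"
  shows "big_q_Jacobi_op a b c p (\<lambda>x. q_shifted_fact x p (Suc s)) x =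
     big_q_Jacobi_eigenvalue a b p (Suc s) * q_shifted_fact x p (Suc s)
     - inverse (p ^ Suc s) * (1 - p ^ Suc s) * (1 - a * p ^ Suc s) * (1 - c * p ^ Suc s)
       * q_shifted_fact x p s"
proof -
  define t where "t = p ^ s"
  define w where "w = q_shifted_fact x p s"
  define v where "v = q_shifted_fact (p * x) p s"
  define i where "i = inverse p"
  define j where "j = inverse t"
  have t: "t \<noteq> 0" using p by (simp add: t_def)
  \<comment> \<open>Inverses enter only through these two equations, which leaves polynomial
    identities for \<open>algebra\<close>.\<close>
  have ip: "i * p = 1" and jt: "j * t = 1" using p t by (simp_all add: i_def j_def)
  have f0: "q_shifted_fact x p (Suc s) = w * (1 - x * t)"
    by (simp add: q_shifted_fact_Suc w_def t_def)
  have f1: "q_shifted_fact (p * x) p (Suc s) = v * (1 - p * x * t)"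
    by (simp add: q_shifted_fact_Suc v_def t_def)
  have "inverse p * x * p = x" using p by simp
  then have f2: "q_shifted_fact (inverse p * x) p (Suc s) = (1 - i * x) * w"
    by (simp only: q_shifted_fact_Suc_shift w_def i_def)
  \<comment> \<open>The last or the first factor is split off the same product.\<close>
  have wv: "w * (1 - x * t) = (1 - x) * v"
    using f0 q_shifted_fact_Suc_shift[of x p s] by (simp add: v_def mult.commute)
  have "x\<^sup>2 * big_q_Jacobi_op a b c p (\<lambda>x. q_shifted_fact x p (Suc s)) x =
     a * p * (x - 1) * (b * x - c) * (v * (1 - p * x * t) - w * (1 - x * t))
     + (x - a * p) * (x - c * p) * ((1 - i * x) * w - w * (1 - x * t))"
    unfolding square_mult_big_q_Jacobi_op[OF x] f0 f1 f2 ..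
  \<comment> \<open>By \<open>wv\<close> the factor \<open>x - 1\<close> absorbs \<open>v\<close>,
    so that only \<open>w\<close> remains.\<close>
  also have "a * p * (x - 1) * (b * x - c) * (v * (1 - p * x * t) - w * (1 - x * t)) =
     - (a * p * (b * x - c) * x * (1 - p * t) * (w * (1 - x * t)))"
    using wv by algebra
  \<comment> \<open>Both summands contain \<open>x * (1 - p * t)\<close>. A second factor
    \<open>x\<close> appears because the constant terms \<open>a * c * p\<close> and
    \<open>i * a * c * p\<^sup>2\<close> of the cofactors cancel.\<close>
  also have "- (a * p * (b * x - c) * x * (1 - p * t) * (w * (1 - x * t)))
       + (x - a * p) * (x - c * p) * ((1 - i * x) * w - w * (1 - x * t)) =
     x\<^sup>2 * (i * j * (1 - p * t) * (1 - a * b * (p * (p * t))) * (w * (1 - x * t))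
       - i * j * (1 - p * t) * (1 - a * (p * t)) * (1 - c * (p * t)) * w)"
    using ip jt by algebra
  finally have "big_q_Jacobi_op a b c p (\<lambda>x. q_shifted_fact x p (Suc s)) x =
     i * j * (1 - p * t) * (1 - a * b * (p * (p * t))) * (w * (1 - x * t))
       - i * j * (1 - p * t) * (1 - a * (p * t)) * (1 - c * (p * t)) * w"
    using x by simp
  then show ?thesis
    unfolding f0 by (simp add: big_q_Jacobi_eigenvalue_def i_def j_def t_def w_def mult_ac)
qed

text \<open>The last two factors are those that the numerator of the expansion coefficient gains
  from \<open>s\<close> to \<open>Suc s\<close>.\<close>

lemma big_q_Jacobi_eigenvalue_diff:
  assumes "p \<noteq> 0"
  shows "big_q_Jacobi_eigenvalue a b p s - big_q_Jacobi_eigenvalue a b p n =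
     inverse (p ^ s) * (1 - inverse (p ^ n) * p ^ s) * (1 - a * b * p ^ (n + 1) * p ^ s)"
  using assms by (simp add: big_q_Jacobi_eigenvalue_def field_simps)

section \<open>The expansion coefficients and their recurrence\<close>

definition big_q_Jacobi_coeff ::
    "complex \<Rightarrow> complex \<Rightarrow> complex \<Rightarrow> complex \<Rightarrow> nat \<Rightarrow> nat \<Rightarrow> complex" where
  "big_q_Jacobi_coeff a b c p n s =
     q_shifted_fact (inverse (p ^ n)) p s * q_shifted_fact (a * b * p ^ (n + 1)) p s
     / (q_shifted_fact (p * a) p s * q_shifted_fact (p * c) p s * q_shifted_fact p p s) * p ^ s"

lemma gamma'_eq_big_q_Jacobi_coeff: "gamma' q a b c n s = big_q_Jacobi_coeff a b c (q\<^sup>2) n s"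
proof -
  have "q ^ (2 * m) = (q\<^sup>2) ^ m" for m by (simp add: power_mult)
  moreover from this[of "n + 1"] have "q ^ (2 * n + 2) = (q\<^sup>2) ^ (n + 1)" by simp
  ultimately show ?thesis
    unfolding gamma'_def big_q_Jacobi_coeff_def by (simp only:)
qed

lemma big_q_Jacobi_coeff_0 [simp]: "big_q_Jacobi_coeff a b c p n 0 = 1"
  by (simp add: big_q_Jacobi_coeff_def)

lemma big_q_Jacobi_coeff_eq_0:
  assumes "p \<noteq> 0" "n < s"
  shows "big_q_Jacobi_coeff a b c p n s = 0"
  using assms by (simp add: big_q_Jacobi_coeff_def q_shifted_fact_inverse_power_eq_0)

text \<open>This is the condition that the basis element of index \<open>s\<close> drops out of the
  eigenvalue equation.\<close>

lemma big_q_Jacobi_coeff_Suc: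
  assumes "p \<noteq> 0" "p ^ Suc s \<noteq> 1" "a * p ^ Suc s \<noteq> 1" "c * p ^ Suc s \<noteq> 1"
  shows "big_q_Jacobi_coeff a b c p n (Suc s) * (inverse (p ^ Suc s) * (1 - p ^ Suc s) *
       (1 - a * p ^ Suc s) * (1 - c * p ^ Suc s)) =
     big_q_Jacobi_coeff a b c p n s *
       (big_q_Jacobi_eigenvalue a b p s - big_q_Jacobi_eigenvalue a b p n)"
proof -
  define N where
    "N = q_shifted_fact (inverse (p ^ n)) p s * q_shifted_fact (a * b * p ^ (n + 1)) p s"
  define D where "D = q_shifted_fact (p * a) p s * q_shifted_fact (p * c) p s * q_shifted_fact p p s"
  define e where "e = (1 - p ^ Suc s) * (1 - a * p ^ Suc s) * (1 - c * p ^ Suc s)"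
  define m where "m = (1 - inverse (p ^ n) * p ^ s) * (1 - a * b * p ^ (n + 1) * p ^ s)"
  have e: "e \<noteq> 0" using assms by (simp add: e_def)
  have S: "big_q_Jacobi_coeff a b c p n (Suc s) = N * m / (D * e) * p ^ Suc s"
    by (simp add: big_q_Jacobi_coeff_def q_shifted_fact_Suc N_def D_def e_def m_def mult_ac)
  have Z: "big_q_Jacobi_coeff a b c p n s = N / D * p ^ s"
    by (simp add: big_q_Jacobi_coeff_def N_def D_def)
  \<comment> \<open>The assumptions concern the index \<open>Suc s\<close> only, so \<open>D\<close>
    may vanish; both sides are then 0.\<close>
  have "N * m / (D * e) * p ^ Suc s * (inverse (p ^ Suc s) * e) = N / D * p ^ s * (inverse (p ^ s) * m)"
    using e assms(1) by (cases "D = 0") (simp_all add: field_simps)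
  then show ?thesis
    unfolding S Z big_q_Jacobi_eigenvalue_diff[OF assms(1)] by (simp add: e_def m_def mult.assoc)
qed

text \<open>By the recurrence the sum telescopes to its top term. The bound \<open>N\<close> is kept
  apart from \<open>n\<close> for the induction; at \<open>N = n\<close> the eigenvalue difference
  is 0.\<close>

lemma big_q_Jacobi_op_partial_sum:
  assumes p: "p \<noteq> 0" and x: "x \<noteq> 0"
    and pn: "\<And>m. m \<ge> 1 \<Longrightarrow> p ^ m \<noteq> 1"
    and a: "\<And>m. m \<ge> 1 \<Longrightarrow> a * p ^ m \<noteq> 1" and c: "\<And>m. m \<ge> 1 \<Longrightarrow> c * p ^ m \<noteq> 1"
  shows "big_q_Jacobi_op a b c p
       (\<lambda>x. \<Sum>s\<le>N. big_q_Jacobi_coeff a b c p n s * q_shifted_fact x p s) x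
     - big_q_Jacobi_eigenvalue a b p n *
         (\<Sum>s\<le>N. big_q_Jacobi_coeff a b c p n s * q_shifted_fact x p s) =
     big_q_Jacobi_coeff a b c p n N *
       (big_q_Jacobi_eigenvalue a b p N - big_q_Jacobi_eigenvalue a b p n) * q_shifted_fact x p N"
proof (induction N)
  case 0
  then show ?case by (simp add: big_q_Jacobi_op_const big_q_Jacobi_eigenvalue_def)
next
  case (Suc N)
  have rec: "big_q_Jacobi_coeff a b c p n (Suc N) * (inverse (p ^ Suc N) * (1 - p ^ Suc N) *
       (1 - a * p ^ Suc N) * (1 - c * p ^ Suc N)) =
     big_q_Jacobi_coeff a b c p n N *
       (big_q_Jacobi_eigenvalue a b p N - big_q_Jacobi_eigenvalue a b p n)"
    using p pn[of "Suc N"] a[of "Suc N"] c[of "Suc N"] by (intro big_q_Jacobi_coeff_Suc) auto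
  \<comment> \<open>Here \<open>l\<close> and \<open>l'\<close> are the eigenvalues of index
    \<open>n\<close> and \<open>Suc N\<close>, and \<open>e\<close> is the one of index
    \<open>N\<close> minus \<open>l\<close>.\<close>
  have telescope: "(T + g' * (l' * f' - m * f)) - l * (S + g' * f') = g' * (l' - l) * f'"
    if "T - l * S = g * e * f" "g' * m = g * e" for T S g g' l l' e f f' m :: complex
    using that by algebra
  show ?case
    unfolding sum.atMost_Suc big_q_Jacobi_op_add big_q_Jacobi_op_cmult
      big_q_Jacobi_op_q_shifted_fact_Suc[OF p x]
    by (rule telescope[OF Suc.IH rec])
qed

section \<open>Existence: the sum as a polynomial solution\<close>

text \<open>The shifted factorial is formed in the polynomial ring, at the indeterminate
  \<open>[:0, 1:]\<close> and with constant base.\<close>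

definition big_q_Jacobi_sum ::
    "complex \<Rightarrow> complex \<Rightarrow> complex \<Rightarrow> complex \<Rightarrow> nat \<Rightarrow> complex poly" where
  "big_q_Jacobi_sum a b c p n =
     (\<Sum>s\<le>n. smult (big_q_Jacobi_coeff a b c p n s) (q_shifted_fact [:0, 1:] [:p:] s))"

lemma poly_big_q_Jacobi_sum:
  "poly (big_q_Jacobi_sum a b c p n) x =
     (\<Sum>s\<le>n. big_q_Jacobi_coeff a b c p n s * q_shifted_fact x p s)"
  by (simp add: big_q_Jacobi_sum_def poly_sum poly_q_shifted_fact)

lemma degree_q_shifted_fact_X:
  fixes p :: "'a::idom"
  assumes "p \<noteq> 0"
  shows "degree (q_shifted_fact [:0, 1:] [:p:] s) = s"
proof -
  have f: "1 - [:0, 1:] * [:p:] ^ k = [:1, - (p ^ k):]" for k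
    by (simp add: poly_const_pow one_pCons)
  show ?thesis
    using assms unfolding q_shifted_fact_def f by (subst degree_prod_eq_sum_degree) auto
qed

text \<open>The basis element of index \<open>s\<close> has degree \<open>s\<close>, so only
  \<open>s = n\<close> contributes in degree \<open>n\<close>.\<close>

lemma degree_big_q_Jacobi_sum:
  assumes p: "p \<noteq> 0" and cn: "big_q_Jacobi_coeff a b c p n n \<noteq> 0"
  shows "degree (big_q_Jacobi_sum a b c p n) = n"
proof (rule antisym)
  show "degree (big_q_Jacobi_sum a b c p n) \<le> n"
    unfolding big_q_Jacobi_sum_def
    by (intro degree_sum_le) (auto intro!: order.trans[OF degree_smult_le]
        simp: degree_q_shifted_fact_X[OF p])
  have "coeff (big_q_Jacobi_sum a b c p n) n =
      (\<Sum>s\<le>n. big_q_Jacobi_coeff a b c p n s * coeff (q_shifted_fact [:0, 1:] [:p:] s) n)"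
    by (simp add: big_q_Jacobi_sum_def coeff_sum)
  also have "\<dots> = (\<Sum>s\<in>{n}. big_q_Jacobi_coeff a b c p n s * coeff (q_shifted_fact [:0, 1:] [:p:] s) n)"
    by (rule sum.mono_neutral_right) (auto simp: degree_q_shifted_fact_X[OF p] intro!: coeff_eq_0)
  also have "\<dots> = big_q_Jacobi_coeff a b c p n n * lead_coeff (q_shifted_fact [:0, 1:] [:p:] n)"
    by (simp add: degree_q_shifted_fact_X[OF p])
  also have "\<dots> \<noteq> 0"
  proof -
    have "q_shifted_fact [:0, 1:] [:p:] n \<noteq> 0"
      using degree_q_shifted_fact_X[OF p, of n] by (cases n) auto
    then show ?thesis using cn by simp
  qed
  finally show "n \<le> degree (big_q_Jacobi_sum a b c p n)" by (rule le_degree)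
qed

text \<open>At 1 the factor \<open>k = 0\<close> kills every basis element except the one of index
  0.\<close>

lemma poly_big_q_Jacobi_sum_1: "poly (big_q_Jacobi_sum a b c p n) 1 = 1"
proof -
  have "poly (big_q_Jacobi_sum a b c p n) 1 =
      (\<Sum>s\<in>{0}. big_q_Jacobi_coeff a b c p n s * q_shifted_fact 1 p s)"
    unfolding poly_big_q_Jacobi_sum
    by (rule sum.mono_neutral_right) (auto simp: q_shifted_fact_eq_0_iff intro!: exI[of _ 0])
  then show ?thesis by simp
qed

text \<open>Zero factors are excluded in the denominator as well, since division by zero would give
  0.\<close>

lemma big_q_Jacobi_coeff_diag_nonzero:
  assumes p: "p \<noteq> 0"
    and pn: "\<And>m. m \<ge> 1 \<Longrightarrow> p ^ m \<noteq> 1"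
    and a: "\<And>m. m \<ge> 1 \<Longrightarrow> a * p ^ m \<noteq> 1" and c: "\<And>m. m \<ge> 1 \<Longrightarrow> c * p ^ m \<noteq> 1"
    and ab: "\<And>m. m \<ge> 2 \<Longrightarrow> a * b * p ^ m \<noteq> 1"
  shows "big_q_Jacobi_coeff a b c p n n \<noteq> 0"
proof -
  have "inverse (p ^ n) * p ^ k \<noteq> 1" if "k < n" for k
  proof
    assume "inverse (p ^ n) * p ^ k = 1"
    moreover have "p ^ n = p ^ k * p ^ (n - k)" using that by (simp flip: power_add)
    ultimately have "p ^ (n - k) = 1" using p by (simp add: field_simps)
    moreover have "n - k \<ge> 1" using that by simp
    ultimately show False using pn by blast
  qed
  \<comment> \<open>Since \<open>k < n\<close> forces \<open>n \<ge> 1\<close>, the exponent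
    \<open>n + 1 + k\<close> is at least 2.\<close>
  moreover have "a * b * p ^ (n + 1) * p ^ k \<noteq> 1" if "k < n" for k
    using ab[of "n + 1 + k"] that by (simp add: power_add mult_ac)
  moreover have "p * a * p ^ k \<noteq> 1" "p * c * p ^ k \<noteq> 1" "p * p ^ k \<noteq> 1" for k
    using a[of "Suc k"] c[of "Suc k"] pn[of "Suc k"] by (auto simp: mult_ac)
  ultimately show ?thesis
    using p by (auto simp: big_q_Jacobi_coeff_def q_shifted_fact_eq_0_iff)
qed

lemma is_big_q_Jacobi_sum:
  assumes p: "p \<noteq> 0"
    and pn: "\<And>m. m \<ge> 1 \<Longrightarrow> p ^ m \<noteq> 1"
    and a: "\<And>m. m \<ge> 1 \<Longrightarrow> a * p ^ m \<noteq> 1" and c: "\<And>m. m \<ge> 1 \<Longrightarrow> c * p ^ m \<noteq> 1"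
    and ab: "\<And>m. m \<ge> 2 \<Longrightarrow> a * b * p ^ m \<noteq> 1"
  shows "is_big_q_Jacobi n a b c p (big_q_Jacobi_sum a b c p n)"
  unfolding is_big_q_Jacobi_iff
proof (intro conjI allI impI)
  show "degree (big_q_Jacobi_sum a b c p n) = n"
    by (intro degree_big_q_Jacobi_sum big_q_Jacobi_coeff_diag_nonzero) (use assms in auto)
  show "poly (big_q_Jacobi_sum a b c p n) 1 = 1"
    by (rule poly_big_q_Jacobi_sum_1)
  fix x :: complex
  assume x: "x \<noteq> 0"
  have "poly (big_q_Jacobi_sum a b c p n) =
      (\<lambda>x. \<Sum>s\<le>n. big_q_Jacobi_coeff a b c p n s * q_shifted_fact x p s)"
    by (rule ext) (rule poly_big_q_Jacobi_sum)
  then show "big_q_Jacobi_op a b c p (poly (big_q_Jacobi_sum a b c p n)) x =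
      big_q_Jacobi_eigenvalue a b p n * poly (big_q_Jacobi_sum a b c p n) x"
    using big_q_Jacobi_op_partial_sum[where n = n and N = n and b = b, OF p x pn a c] by simp
qed

section \<open>Uniqueness by comparison of leading coefficients\<close>

text \<open>Multiplied by \<open>x\<^sup>2\<close>, the equation is an identity of polynomials; its
  coefficients in degree \<open>degree d + 2\<close> determine \<open>l\<close>.\<close>

lemma big_q_Jacobi_eigenpoly_eigenvalue:
  assumes p: "p \<noteq> 0" and d: "d \<noteq> 0"
    and eq: "\<And>x. x \<noteq> 0 \<Longrightarrow> big_q_Jacobi_op a b c p (poly d) x = l * poly d x"
  shows "l = big_q_Jacobi_eigenvalue a b p (degree d)"
proof -
  define k where "k = degree d"
  define u where "u = pcompose d [:0, p:] - d"
  define v where "v = pcompose d [:0, inverse p:] - d"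
  define A where "A = smult (a * p) ([:-1, 1:] * [:- c, b:])"
  define C where "C = [:- (a * p), 1:] * [:- (c * p), 1:]"
  \<comment> \<open>The identity extends to 0, where \<open>u\<close>, \<open>v\<close> and the
    factor \<open>x\<^sup>2\<close> all vanish.\<close>
  have "poly (monom l 2 * d) x = poly (A * u + C * v) x" for x
  proof (cases "x = 0")
    case True
    then show ?thesis by (simp add: u_def v_def poly_pcompose poly_monom)
  next
    case False
    have "poly (monom l 2 * d) x = x\<^sup>2 * big_q_Jacobi_op a b c p (poly d) x"
      using eq[OF False] by (simp add: poly_monom)
    also have "\<dots> = poly (A * u + C * v) x"
      unfolding square_mult_big_q_Jacobi_op[OF False]
      by (simp add: A_def C_def u_def v_def poly_pcompose algebra_simps)
    finally show ?thesis .
  qed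
  then have P: "monom l 2 * d = A * u + C * v"
    by (simp add: poly_eq_poly_eq_iff[symmetric] fun_eq_iff)
  have cf: "coeff (pcompose d [:0, r:]) i = r ^ i * coeff d i" for r :: complex and i
    by (rule coeff_pcompose_linear)
  have quad: "coeff ([:r0, r1, r2:] * w) (k + 2) = r2 * coeff w k"
    if "\<And>i. i > k \<Longrightarrow> coeff w i = 0" for r0 r1 r2 :: complex and w
    using that by (simp add: mult_pCons_left coeff_pCons)
  have hi: "coeff u i = 0" "coeff v i = 0" if "i > k" for i
    using that by (simp_all add: u_def v_def cf k_def coeff_eq_0)
  have quad_u: "coeff ([:r0, r1, r2:] * u) (k + 2) = r2 * coeff u k"
    and quad_v: "coeff ([:r0, r1, r2:] * v) (k + 2) = r2 * coeff v k" for r0 r1 r2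
    by (rule quad, erule hi)+
  have A: "A = [:a * p * c, - (a * p * (b + c)), a * b * p:]"
    and C: "C = [:a * c * p\<^sup>2, - ((a + c) * p), 1:]"
    by (simp_all add: A_def C_def algebra_simps power2_eq_square)
  have "l * coeff d k = coeff (monom l 2 * d) (k + 2)"
    by (simp add: coeff_monom_mult)
  also have "\<dots> = a * b * p * coeff u k + coeff v k"
    unfolding P A C coeff_add quad_u quad_v by simp
  also have "\<dots> = (a * b * p * (p ^ k - 1) + (inverse p ^ k - 1)) * coeff d k"
    by (simp add: u_def v_def cf algebra_simps)
  also have "\<dots> = big_q_Jacobi_eigenvalue a b p k * coeff d k"
    using p by (simp add: big_q_Jacobi_eigenvalue_def field_simps)
  finally show ?thesis using d by (simp add: k_def)
qed

text \<open>Equality would force \<open>p ^ (n - k) = 1\<close> or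
  \<open>a * b * p ^ (n + k + 1) = 1\<close>, with exponents at least 1 and 2.\<close>

lemma big_q_Jacobi_eigenvalue_neq:
  assumes p: "p \<noteq> 0" and kn: "k < n"
    and pn: "\<And>m. m \<ge> 1 \<Longrightarrow> p ^ m \<noteq> 1"
    and ab: "\<And>m. m \<ge> 2 \<Longrightarrow> a * b * p ^ m \<noteq> 1"
  shows "big_q_Jacobi_eigenvalue a b p n \<noteq> big_q_Jacobi_eigenvalue a b p k"
proof -
  have "p ^ n = p ^ k * p ^ (n - k)" using kn by (simp flip: power_add)
  then have "1 - inverse (p ^ k) * p ^ n \<noteq> 0"
    using p pn[of "n - k"] kn by (simp add: mult.assoc[symmetric])
  moreover have "1 - a * b * p ^ (k + 1) * p ^ n \<noteq> 0"
    using ab[of "k + 1 + n"] kn by (simp add: power_add mult_ac)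
  ultimately have "big_q_Jacobi_eigenvalue a b p n - big_q_Jacobi_eigenvalue a b p k \<noteq> 0"
    unfolding big_q_Jacobi_eigenvalue_diff[OF p] using p by simp
  then show ?thesis by simp
qed

lemma is_big_q_Jacobi_unique:
  assumes p: "p \<noteq> 0"
    and pn: "\<And>m. m \<ge> 1 \<Longrightarrow> p ^ m \<noteq> 1"
    and ab: "\<And>m. m \<ge> 2 \<Longrightarrow> a * b * p ^ m \<noteq> 1"
    and y1: "is_big_q_Jacobi n a b c p y1" and y2: "is_big_q_Jacobi n a b c p y2"
  shows "y1 = y2"
proof -
  have deg: "degree y1 = n" "degree y2 = n" and one: "poly y1 1 = 1" "poly y2 1 = 1"
    using y1 y2 by (auto simp: is_big_q_Jacobi_iff)
  define r1 r2 where "r1 = coeff y1 n" and "r2 = coeff y2 n"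
  \<comment> \<open>Cross-multiplication cancels the leading terms, so a nonzero \<open>d\<close>
    would solve the equation for \<open>n\<close> with degree below \<open>n\<close>.\<close>
  define d where "d = smult r2 y1 - smult r1 y2"
  have "y1 \<noteq> 0" using one by auto
  then have r1: "r1 \<noteq> 0" using deg by (auto simp: r1_def)
  have "d = 0"
  proof (rule ccontr)
    assume d: "d \<noteq> 0"
    have "degree d \<le> n"
      unfolding d_def using deg
      by (intro degree_diff_le) (auto intro!: order.trans[OF degree_smult_le])
    moreover have "coeff d n = 0" by (simp add: d_def r1_def r2_def)
    ultimately have lt: "degree d < n"
      using d by (metis leading_coeff_0_iff order_le_less)
    have "big_q_Jacobi_op a b c p (poly d) x = big_q_Jacobi_eigenvalue a b p n * poly d x"
      if "x \<noteq> 0" for x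
    proof -
      have "poly d = (\<lambda>x. r2 * poly y1 x + (- r1) * poly y2 x)"
        by (simp add: d_def fun_eq_iff)
      then have "big_q_Jacobi_op a b c p (poly d) x =
          r2 * big_q_Jacobi_op a b c p (poly y1) x + (- r1) * big_q_Jacobi_op a b c p (poly y2) x"
        by (simp only: big_q_Jacobi_op_add big_q_Jacobi_op_cmult)
      then show ?thesis
        using y1 y2 that by (simp add: is_big_q_Jacobi_iff d_def algebra_simps)
    qed
    then have "big_q_Jacobi_eigenvalue a b p n = big_q_Jacobi_eigenvalue a b p (degree d)"
      using p d by (intro big_q_Jacobi_eigenpoly_eigenvalue) auto
    then show False
      using big_q_Jacobi_eigenvalue_neq[OF p lt pn ab] by simp
  qed
  then have eq: "smult r2 y1 = smult r1 y2" by (simp add: d_def)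
  then have "poly (smult r2 y1) 1 = poly (smult r1 y2) 1" by simp
  \<comment> \<open>The solutions are proportional, and the normalization at 1 fixes the
    factor.\<close>
  then have "r2 = r1" using one by simp
  then show ?thesis using eq r1 by (metis smult_cancel)
qed

section \<open>Identification of the polynomial and the series expansion\<close>

lemma big_q_Jacobi_eq_sum:
  assumes "p \<noteq> 0"
    and "\<And>m. m \<ge> 1 \<Longrightarrow> p ^ m \<noteq> 1"
    and "\<And>m. m \<ge> 1 \<Longrightarrow> a * p ^ m \<noteq> 1" and "\<And>m. m \<ge> 1 \<Longrightarrow> c * p ^ m \<noteq> 1"
    and "\<And>m. m \<ge> 2 \<Longrightarrow> a * b * p ^ m \<noteq> 1"
  shows "big_q_Jacobi n a b c p = big_q_Jacobi_sum a b c p n"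
  unfolding big_q_Jacobi_def
  by (intro the_equality is_big_q_Jacobi_sum) (use assms is_big_q_Jacobi_unique is_big_q_Jacobi_sum in blast)+

theorem proposition5p2:
  fixes q lq \<nu> qnu cbar0 eps0 a b c z :: complex and n :: nat
  assumes q_nonzero: "q \<noteq> 0"
    and q_not_root_of_unity: "\<And>k::nat. k \<ge> 1 \<Longrightarrow> q ^ k \<noteq> 1"
    and nu: "\<And>k::nat. 2 * \<nu> \<noteq> of_nat k"
    and q_log: "exp lq = q"
    and qnu: "qnu = exp (\<nu> * lq)"
    and cbar0: "cbar0 \<noteq> 0"
    and alpha: "W0_alpha q qnu cbar0 eps0 = q\<^sup>2 * b"
    and b: "q\<^sup>2 * b \<noteq> 0"
    and a: "\<And>m::nat. m \<ge> 1 \<Longrightarrow> a * q ^ (2 * m) \<noteq> 1"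
    and c: "\<And>m::nat. m \<ge> 1 \<Longrightarrow> c * q ^ (2 * m) \<noteq> 1"
    and ab: "\<And>m::nat. m \<ge> 2 \<Longrightarrow> a * b * q ^ (2 * m) \<noteq> 1"
  shows "(\<lambda>s. gamma' q a b c n s * W0_eigenfun q qnu cbar0 eps0 s z)
           sums poly (big_q_Jacobi n a b c (q\<^sup>2)) (q\<^sup>2 * b * z)"
proof -
  define p where "p = q\<^sup>2"
  have p: "p \<noteq> 0" using q_nonzero by (simp add: p_def)
  have pm: "p ^ m = q ^ (2 * m)" for m by (simp add: p_def power_mult)
  have J: "big_q_Jacobi n a b c p = big_q_Jacobi_sum a b c p n"
    by (rule big_q_Jacobi_eq_sum)
      (use p a c ab q_not_root_of_unity in \<open>simp_all add: pm\<close>)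
  \<comment> \<open>The coefficients vanish for \<open>s > n\<close>, so the series is a finite
    sum.\<close>
  have "(\<lambda>s. big_q_Jacobi_coeff a b c p n s * q_shifted_fact (p * b * z) p s) sums
      (\<Sum>s\<le>n. big_q_Jacobi_coeff a b c p n s * q_shifted_fact (p * b * z) p s)"
    by (rule sums_finite) (auto simp: big_q_Jacobi_coeff_eq_0[OF p])
  then show ?thesis
    unfolding gamma'_eq_big_q_Jacobi_coeff W0_eigenfun_def alpha p_def[symmetric] J
      poly_big_q_Jacobi_sum .
qed

end
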